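(* For the square game on the square grid with $n$ winning sets, $\mathrm{SC}_2(\mathcal G_{\square},2)\ge \frac{2n}{3}-o(n)$.
   Context: An $s$-of-$k$ game on a $k$-uniform hypergraph $(V,\mathcal F)$ (winning sets are $k$-element subsets of the finite set $V$), $1\le s\le k$: Maker and Breaker alternately claim unclaimed vertices, Maker first, until all are claimed; the score is the number of winning sets in which Maker claimed at least $s$ vertices (Maker maximizes, Breaker minimizes). A pairing strategy for Maker: she fixes in advance pairwise disjoint pairs of vertices and, whenever Breaker claims a vertex of a pair whose partner is unclaimed, she claims the partner (other moves arbitrary). $\mathrm{SC}_2(\mathcal H,s)$ is the largest score Maker can guarantee against every Breaker strategy using a pairing strategy. $\mathcal G_{\square}$ is the hypergraph whose vertices are the points of a finite portion of the square lattice and whose winning sets are the sets of four corners of the unit square faces, so $k=4$. Grids are assumed "two-dimensional": the number of winning sets within constant distance of the boundary is $o(n)$, where $n$ is the number of winning sets; $o(n)$ refers to $n\to\infty$. *)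

theory Defs
  imports Complex_Main "HOL-Library.Landau_Symbols" "HOL-Library.Disjoint_Sets"
begin

section \<open>Scoring games on uniform hypergraphs\<close>

type_synonym 'v hypergraph = "'v set \<times> 'v set set"

abbreviation verts :: "'v hypergraph \<Rightarrow> 'v set" where "verts H \<equiv> fst H"
abbreviation winning_sets :: "'v hypergraph \<Rightarrow> 'v set set" where "winning_sets H \<equiv> snd H"

definition uniform_hypergraph :: "nat \<Rightarrow> 'v hypergraph \<Rightarrow> bool" where
  "uniform_hypergraph k H \<longleftrightarrow>
     finite (verts H) \<and> (\<forall>A\<in>winning_sets H. A \<subseteq> verts H \<and> card A = k)"

text \<open>
  A history is the list of the vertices claimed so far, in order. Maker moves first, so she
  owns the entries at even positions and is to move after a history of even length.
\<close>

definition maker_claims :: "'v list \<Rightarrow> 'v set" where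
  "maker_claims h = {h ! i | i. i < length h \<and> even i}"

definition unfinished :: "'v hypergraph \<Rightarrow> 'v list \<Rightarrow> bool" where
  "unfinished H h \<longleftrightarrow> distinct h \<and> set h \<subset> verts H"

type_synonym 'v strategy = "'v list \<Rightarrow> 'v"

definition maker_strategy :: "'v hypergraph \<Rightarrow> 'v strategy \<Rightarrow> bool" where
  "maker_strategy H \<sigma> \<longleftrightarrow>
     (\<forall>h. unfinished H h \<and> even (length h) \<longrightarrow> \<sigma> h \<in> verts H - set h)"

definition breaker_strategy :: "'v hypergraph \<Rightarrow> 'v strategy \<Rightarrow> bool" where
  "breaker_strategy H \<tau> \<longleftrightarrow>
     (\<forall>h. unfinished H h \<and> odd (length h) \<longrightarrow> \<tau> h \<in> verts H - set h)"

fun play :: "'v strategy \<Rightarrow> 'v strategy \<Rightarrow> nat \<Rightarrow> 'v list" where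
  "play \<sigma> \<tau> 0 = []"
| "play \<sigma> \<tau> (Suc m) =
     (let h = play \<sigma> \<tau> m in h @ [if even m then \<sigma> h else \<tau> h])"

text \<open>The score of the complete play, in which all vertices have been claimed.\<close>

definition score :: "'v hypergraph \<Rightarrow> nat \<Rightarrow> 'v strategy \<Rightarrow> 'v strategy \<Rightarrow> nat" where
  "score H s \<sigma> \<tau> =
     card {A \<in> winning_sets H. s \<le> card (A \<inter> maker_claims (play \<sigma> \<tau> (card (verts H))))}"

section \<open>Pairing strategies\<close>

definition pairing :: "'v hypergraph \<Rightarrow> 'v set set \<Rightarrow> bool" where
  "pairing H P \<longleftrightarrow> (\<forall>p\<in>P. p \<subseteq> verts H \<and> card p = 2) \<and> disjoint P"

definition pairing_strategy :: "'v hypergraph \<Rightarrow> 'v set set \<Rightarrow> 'v strategy \<Rightarrow> bool" where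
  "pairing_strategy H P \<sigma> \<longleftrightarrow> maker_strategy H \<sigma> \<and>
     (\<forall>h w. unfinished H h \<and> even (length h) \<and> h \<noteq> [] \<and> {last h, w} \<in> P \<and> w \<notin> set h
        \<longrightarrow> \<sigma> h = w)"

text \<open>
  Maker only commits to the pairing; her moves that are not forced by it are arbitrary, so the
  guarantee has to hold for every strategy \<open>\<sigma>\<close> following the pairing. (Were \<open>\<sigma>\<close> existentially
  quantified, the empty pairing would allow every strategy of Maker, and the restriction to
  pairing strategies would be void.)
\<close>

definition pairing_guarantees :: "'v hypergraph \<Rightarrow> nat \<Rightarrow> 'v set set \<Rightarrow> nat \<Rightarrow> bool" where
  "pairing_guarantees H s P c \<longleftrightarrow>
     (\<forall>\<sigma> \<tau>. pairing_strategy H P \<sigma> \<and> breaker_strategy H \<tau> \<longrightarrow> c \<le> score H s \<sigma> \<tau>)"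

definition SC2 :: "'v hypergraph \<Rightarrow> nat \<Rightarrow> nat" where
  "SC2 H s = (GREATEST c. \<exists>P. pairing H P \<and> pairing_guarantees H s P c)"

section \<open>Portions of the square lattice\<close>

fun unit_square :: "int \<times> int \<Rightarrow> (int \<times> int) set" where
  "unit_square (x, y) = {(x, y), (x + 1, y), (x, y + 1), (x + 1, y + 1)}"

definition square_grid :: "(int \<times> int) set \<Rightarrow> (int \<times> int) hypergraph" where
  "square_grid V = (V, {unit_square p | p. unit_square p \<subseteq> V})"

definition num_squares :: "(int \<times> int) set \<Rightarrow> nat" where
  "num_squares V = card (winning_sets (square_grid V))"

fun lattice_dist :: "int \<times> int \<Rightarrow> int \<times> int \<Rightarrow> nat" where
  "lattice_dist (x, y) (x', y') = nat (\<bar>x - x'\<bar> + \<bar>y - y'\<bar>)"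

definition boundary :: "(int \<times> int) set \<Rightarrow> (int \<times> int) set" where
  "boundary V = {v \<in> V. \<exists>w. w \<notin> V \<and> lattice_dist v w = 1}"

definition squares_near_boundary :: "nat \<Rightarrow> (int \<times> int) set \<Rightarrow> (int \<times> int) set set" where
  "squares_near_boundary d V =
     {A \<in> winning_sets (square_grid V). \<exists>v\<in>A. \<exists>b\<in>boundary V. lattice_dist v b \<le> d}"

text \<open>
  Two-dimensionality and \<open>o(n)\<close> are asymptotic notions, so they are stated for a sequence of
  finite portions of the lattice along which the number of squares tends to infinity.
\<close>

definition two_dimensional :: "(nat \<Rightarrow> (int \<times> int) set) \<Rightarrow> bool" where
  "two_dimensional V \<longleftrightarrow>
     (\<forall>d. (\<lambda>i. real (card (squares_near_boundary d (V i)))) \<in> o(\<lambda>i. real (num_squares (V i))))"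

lemma uniform_square_grid: "finite V \<Longrightarrow> uniform_hypergraph 4 (square_grid V)"
  by (auto simp: uniform_hypergraph_def square_grid_def)

end

theory Submission imports Defs begin

text \<open>
  Maker pairs the lattice points into the vertical dominoes \<open>{(x, 2j), (x, 2j + 1)}\<close> and so owns
  a point of every domino. A square whose lower side lies at even height consists of two dominoes
  and always scores. Of the squares with odd lower side, take three consecutive ones in a column:
  together they contain four dominoes, hence at least four of Maker's points, so one of them
  scores. Thus at least four of any six consecutive squares of a column score (cut at multiples of
  six), and the squares whose block of six is incomplete lie at bounded distance from the boundary.
\<close>

section \<open>Plays following a pairing\<close>

lemma length_play [simp]: "length (play \<sigma> \<tau> m) = m"
  by (induction m) (auto simp: Let_def)

text \<open>This identifies every prefix of the complete play with the history that a strategy saw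
  at that moment.\<close>

lemma take_play: "k \<le> m \<Longrightarrow> take k (play \<sigma> \<tau> m) = play \<sigma> \<tau> k"
proof (induction m)
  case (Suc m)
  then show ?case by (cases "k = Suc m") (auto simp: Let_def)
qed auto

lemma play_legal:
  assumes "finite (verts H)" "maker_strategy H \<sigma>" "breaker_strategy H \<tau>" "m \<le> card (verts H)"
  shows "distinct (play \<sigma> \<tau> m) \<and> set (play \<sigma> \<tau> m) \<subseteq> verts H"
  using assms(4)
proof (induction m)
  case (Suc m)
  let ?h = "play \<sigma> \<tau> m"
  have IH: "distinct ?h" "set ?h \<subseteq> verts H" using Suc by auto
  have "set ?h \<noteq> verts H"
    using Suc.prems distinct_card[OF IH(1)] by auto
  then have "unfinished H ?h" using IH by (auto simp: unfinished_def)
  then have "(if even m then \<sigma> ?h else \<tau> ?h) \<in> verts H - set ?h"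
    using assms(2,3) by (auto simp: maker_strategy_def breaker_strategy_def)
  then show ?case using IH by (auto simp: Let_def)
qed auto

lemma set_complete_play:
  assumes "finite (verts H)" "maker_strategy H \<sigma>" "breaker_strategy H \<tau>"
  shows "set (play \<sigma> \<tau> (card (verts H))) = verts H"
  using play_legal[OF assms order.refl] assms(1)
  by (metis card_subset_eq distinct_card length_play)

text \<open>Look at the vertex of the pair that is claimed first. If its position is even, Maker
  owns it; if odd, Breaker took it, the partner is still free, and the forced reply puts the partner
  at the next, even, position.\<close>

lemma maker_claims_meets_pair:
  assumes fin: "finite (verts H)" and P: "pairing H P"
    and \<sigma>: "pairing_strategy H P \<sigma>" and \<tau>: "breaker_strategy H \<tau>" and ab: "{a, b} \<in> P"
  shows "a \<in> maker_claims (play \<sigma> \<tau> (card (verts H)))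
    \<or> b \<in> maker_claims (play \<sigma> \<tau> (card (verts H)))"
proof -
  let ?N = "card (verts H)"
  define h where "h = play \<sigma> \<tau> ?N"
  have mk: "maker_strategy H \<sigma>" using \<sigma> by (simp add: pairing_strategy_def)
  have dist: "distinct h" and seth: "set h = verts H" and len: "length h = ?N"
    using play_legal[OF fin mk \<tau> order.refl] set_complete_play[OF fin mk \<tau>] by (auto simp: h_def)
  have "{a, b} \<subseteq> verts H" "card {a, b} = 2" using P ab by (auto simp: pairing_def)
  then have "a \<in> set h" "b \<in> set h" "a \<noteq> b" using seth by auto
  then obtain i j where i: "i < ?N" "h ! i = a" and j: "j < ?N" "h ! j = b" and "i \<noteq> j"
    by (metis in_set_conv_nth len)
  have answer: "even j'" if "i' < j'" "j' < ?N" "odd i'" "{h ! i', h ! j'} \<in> P" for i' j'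
  proof -
    let ?g = "play \<sigma> \<tau> (Suc i')"
    have g: "?g = take (Suc i') h" using that by (subst h_def, subst take_play) auto
    have last: "last ?g = h ! i'"
      using that len unfolding g by (simp add: take_Suc_conv_app_nth)
    have new: "h ! j' \<notin> set ?g"
      using that len dist unfolding g by (auto simp: in_set_conv_nth nth_eq_iff_index_eq)
    moreover have "h ! j' \<in> verts H" using that len seth nth_mem by metis
    ultimately have "unfinished H ?g"
      using play_legal[OF fin mk \<tau>, of "Suc i'"] that by (auto simp: unfinished_def)
    moreover have "?g \<noteq> []" by (metis length_play list.size(3) nat.simps(3))
    moreover have "even (length ?g)" using that by (simp del: play.simps)
    moreover have "{last ?g, h ! j'} \<in> P" unfolding last by (rule that(4))
    ultimately have "\<sigma> ?g = h ! j'"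
      using \<sigma> new unfolding pairing_strategy_def by blast
    moreover have "h ! Suc i' = \<sigma> ?g"
    proof -
      have "h ! Suc i' = take (Suc (Suc i')) h ! Suc i'" by simp
      also have "take (Suc (Suc i')) h = play \<sigma> \<tau> (Suc (Suc i'))"
        using that unfolding h_def by (intro take_play) simp
      also have "play \<sigma> \<tau> (Suc (Suc i')) ! Suc i' = \<sigma> ?g"
        using that by (subst play.simps) (simp add: Let_def nth_append del: play.simps)
      finally show ?thesis .
    qed
    \<comment> \<open>The positions \<open>Suc i'\<close> and \<open>j'\<close> hold the same
      vertex, and \<open>h\<close> has no repetitions.\<close>
    ultimately have "Suc i' = j'"
      using that dist len by (metis Suc_lessI less_trans nth_eq_iff_index_eq)
    then show ?thesis using that by auto
  qed
  have "even i \<or> even j"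
  proof (cases "i < j")
    case True
    then show ?thesis using answer[of i j] i j ab by auto
  next
    case False
    then show ?thesis using answer[of j i] i j ab \<open>i \<noteq> j\<close> by (auto simp: insert_commute)
  qed
  then show ?thesis using i j len unfolding maker_claims_def h_def by auto
qed

section \<open>Existence of strategies and lower bounds on \<open>SC2\<close>\<close>

lemma ex_breaker_strategy: "\<exists>\<tau>. breaker_strategy H \<tau>"
proof -
  have "(SOME v. v \<in> verts H - set h) \<in> verts H - set h" if "unfinished H h" for h
  proof (rule someI_ex)
    show "\<exists>v. v \<in> verts H - set h" using that by (auto simp: unfinished_def)
  qed
  then have "breaker_strategy H (\<lambda>h. SOME v. v \<in> verts H - set h)"
    by (simp add: breaker_strategy_def)
  then show ?thesis by blast
qed

text \<open>Disjointness of the pairs makes the forced reply unique, so a choice function that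
  prefers forced vertices obeys every demand of the pairing.\<close>

lemma ex_pairing_strategy:
  assumes P: "pairing H P"
  shows "\<exists>\<sigma>. pairing_strategy H P \<sigma>"
proof -
  define forced where "forced h w \<longleftrightarrow> h \<noteq> [] \<and> {last h, w} \<in> P \<and> w \<notin> set h" for h w
  define \<sigma> where "\<sigma> h = (if \<exists>w. forced h w then SOME w. forced h w
      else SOME v. v \<in> verts H - set h)" for h
  have forced: "\<sigma> h = w" if "forced h w" for h w
  proof -
    have "forced h (\<sigma> h)" using that someI[of "forced h" w] by (auto simp: \<sigma>_def)
    then have *: "{last h, \<sigma> h} \<in> P" "{last h, w} \<in> P" "w \<noteq> last h"
      using that by (auto simp: forced_def)
    then have "{last h, \<sigma> h} = {last h, w}"
      using P disjointD[of P "{last h, \<sigma> h}" "{last h, w}"] by (auto simp: pairing_def)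
    then show ?thesis using *(3) by (auto simp: doubleton_eq_iff)
  qed
  have "\<sigma> h \<in> verts H - set h" if "unfinished H h" for h
  proof (cases "\<exists>w. forced h w")
    case True
    then obtain w where w: "forced h w" by blast
    then show ?thesis using forced[OF w] P by (auto simp: forced_def pairing_def)
  next
    case False
    moreover have "\<exists>v. v \<in> verts H - set h" using that by (auto simp: unfinished_def)
    ultimately show ?thesis unfolding \<sigma>_def by (simp only: if_False) (rule someI_ex)
  qed
  then have "pairing_strategy H P \<sigma>"
    using forced unfolding pairing_strategy_def maker_strategy_def forced_def by blast
  then show ?thesis by blast
qed

text \<open>\<open>GREATEST\<close> is informative only for a bounded set of values. Since
  strategies for both players exist, every guaranteed value is at most the score of an actual play,
  hence at most the number of winning sets.\<close>

lemma SC2_ge: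
  assumes fin: "finite (winning_sets H)" and "pairing H P" "pairing_guarantees H s P c"
  shows "c \<le> SC2 H s"
  unfolding SC2_def
proof (rule Greatest_le_nat)
  show "\<exists>P. pairing H P \<and> pairing_guarantees H s P c" using assms by blast
  fix c' assume "\<exists>P. pairing H P \<and> pairing_guarantees H s P c'"
  then obtain Q where Q: "pairing H Q" "pairing_guarantees H s Q c'" by blast
  obtain \<sigma> \<tau> where "pairing_strategy H Q \<sigma>" "breaker_strategy H \<tau>"
    using ex_pairing_strategy[OF Q(1)] ex_breaker_strategy by blast
  then have "c' \<le> score H s \<sigma> \<tau>" using Q(2) by (auto simp: pairing_guarantees_def)
  also have "\<dots> \<le> card (winning_sets H)"
    unfolding score_def using fin by (intro card_mono) auto
  finally show "c' \<le> card (winning_sets H)" .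
qed

section \<open>Squares and dominoes\<close>

lemma lattice_dist_triangle: "lattice_dist u w \<le> lattice_dist u v + lattice_dist v w"
proof -
  obtain a b where u: "u = (a, b)" by (cases u)
  obtain c d where v: "v = (c, d)" by (cases v)
  obtain e f where w: "w = (e, f)" by (cases w)
  have int_dist: "int (lattice_dist (p, q) (p', q')) = \<bar>p - p'\<bar> + \<bar>q - q'\<bar>" for p q p' q'
    by simp
  have "\<bar>a - e\<bar> + \<bar>b - f\<bar> \<le> (\<bar>a - c\<bar> + \<bar>c - e\<bar>) + (\<bar>b - d\<bar> + \<bar>d - f\<bar>)"
    by (rule add_mono; linarith)
  also have "\<dots> = int (lattice_dist u v + lattice_dist v w)"
    by (simp only: u v w int_dist of_nat_add ac_simps)
  finally show ?thesis by (simp only: u w int_dist flip: of_nat_le_iff[where 'a = int])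
qed

lemma lattice_dist_step:
  assumes "lattice_dist v w = Suc n"
  obtains v' where "lattice_dist v v' = 1" "lattice_dist v' w = n"
proof -
  obtain x y x' y' where v: "v = (x, y)" and w: "w = (x', y')" by (cases v; cases w)
  \<comment> \<open>A shortest path: adjust the first coordinate until it agrees, then the
    second.\<close>
  let ?v' = "if x \<noteq> x' then (x + sgn (x' - x), y) else (x, y + sgn (y' - y))"
  have "lattice_dist v ?v' = 1" "lattice_dist ?v' w = n"
    using assms by (auto simp: v w sgn_if split: if_splits)
  then show ?thesis by (rule that)
qed

text \<open>Walk from \<open>v\<close> to \<open>w\<close> along a shortest path. The last point
  before the path first leaves \<open>V\<close> is a boundary point, and it is no farther from
  \<open>v\<close> than \<open>w\<close> is.\<close>

lemma boundary_within_dist: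
  assumes "v \<in> V" "w \<notin> V"
  shows "\<exists>b\<in>boundary V. lattice_dist v b \<le> lattice_dist v w"
  using assms
proof (induction "lattice_dist v w" arbitrary: v)
  case 0
  then have "v = w" by (cases v; cases w) auto
  then show ?case using 0 by blast
next
  case (Suc n)
  obtain v' where v': "lattice_dist v v' = 1" "lattice_dist v' w = n"
    using lattice_dist_step Suc.hyps(2) by metis
  show ?case
  proof (cases "v' \<in> V")
    case True
    then obtain b where "b \<in> boundary V" "lattice_dist v' b \<le> n"
      using Suc.hyps(1) Suc.prems v' by blast
    then show ?thesis
      using lattice_dist_triangle[of v b v'] v' Suc.hyps(2) by (intro bexI[of _ b]) auto
  next
    case False
    then have "v \<in> boundary V" using v'(1) Suc.prems(1) unfolding boundary_def by blast
    moreover have "lattice_dist v v = 0" by (cases v) simp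
    ultimately show ?thesis by (intro bexI[of _ v]) auto
  qed
qed

lemma inj_unit_square: "inj unit_square"
proof (rule injI)
  fix p q assume eq: "unit_square p = unit_square q"
  obtain x y x' y' where pq: "p = (x, y)" "q = (x', y')" by (cases p; cases q)
  \<comment> \<open>Each of \<open>p\<close> and \<open>q\<close> is the lower left corner of its
    own square; lying in the other's square as well, each dominates the other
    coordinatewise.\<close>
  have "p \<in> unit_square p" "q \<in> unit_square q" by (simp_all add: pq)
  then have "p \<in> unit_square q" "q \<in> unit_square p" by (simp_all only: eq)
  then show "p = q" by (auto simp: pq)
qed

lemma card_unit_square_Int:
  "card (unit_square (x, y) \<inter> M) = of_bool ((x, y) \<in> M) + of_bool ((x + 1, y) \<in> M)
     + of_bool ((x, y + 1) \<in> M) + of_bool ((x + 1, y + 1) \<in> M)"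
proof -
  have "card (unit_square (x, y) \<inter> M) = (\<Sum>p\<in>unit_square (x, y). of_bool (p \<in> M))"
    by (simp add: sum_of_bool_eq)
  then show ?thesis by (simp add: add.assoc)
qed

section \<open>The domino pairing and blocks of six squares\<close>

definition dominoes :: "(int \<times> int) set \<Rightarrow> (int \<times> int) set set" where
  "dominoes V = {{(x, 2 * j), (x, 2 * j + 1)} | x j. (x, 2 * j) \<in> V \<and> (x, 2 * j + 1) \<in> V}"

text \<open>Disjointness is a matter of parity: a point \<open>(x, y)\<close> can lie only in the
  domino with \<open>j = y div 2\<close>.\<close>

lemma pairing_dominoes: "pairing (square_grid V) (dominoes V)"
proof -
  have "disjoint (dominoes V)"
    unfolding disjoint_def dominoes_def by (auto; presburger)
  then show ?thesis by (auto simp: pairing_def dominoes_def square_grid_def)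
qed

text \<open>A block consists of the lower left corners of its squares, not of the points these
  squares cover. The length six is even, so blocks respect the dominoes, and it allows three squares
  of either parity.\<close>

definition column_block :: "int \<times> int \<Rightarrow> (int \<times> int) set" where
  "column_block = (\<lambda>(x, m). {x} \<times> {6 * m..6 * m + 5})"

lemma card_column_block: "card (column_block k) = 6"
  by (cases k) (simp add: column_block_def card_cartesian_product_singleton)

lemma finite_column_block: "finite (column_block k)"
  by (cases k) (simp add: column_block_def)

text \<open>Blocks are the fibres of a map, so they partition the lattice.\<close>

lemma mem_column_block_iff: "p \<in> column_block k \<longleftrightarrow> k = (fst p, snd p div 6)"
proof (cases k; cases p)
  fix x m u v :: int assume "k = (x, m)" "p = (u, v)"
  moreover have "6 * m \<le> v \<and> v \<le> 6 * m + 5 \<longleftrightarrow> m = v div 6" by presburger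
  ultimately show ?thesis by (auto simp: column_block_def)
qed

lemma column_block_disjoint: "k \<noteq> k' \<Longrightarrow> column_block k \<inter> column_block k' = {}"
  by (auto simp: mem_column_block_iff)

lemma column_block_score:
  assumes sub: "\<And>p. p \<in> column_block k \<Longrightarrow> unit_square p \<subseteq> V"
    and M: "\<And>a b. {a, b} \<in> dominoes V \<Longrightarrow> a \<in> M \<or> b \<in> M"
  shows "4 \<le> card {p \<in> column_block k. 2 \<le> card (unit_square p \<inter> M)}"
proof -
  obtain x m where k: "k = (x, m)" by (cases k)
  \<comment> \<open>The 0/1 indicator turns the counting of Maker's points into linear
    arithmetic.\<close>
  define \<mu> :: "int \<times> int \<Rightarrow> nat" where "\<mu> p = of_bool (p \<in> M)" for p
  have card_sq: "card (unit_square (u, v) \<inter> M) = \<mu> (u, v) + \<mu> (u + 1, v) + \<mu> (u, v + 1) + \<mu> (u + 1, v + 1)"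
    for u v by (simp only: card_unit_square_Int \<mu>_def)
  have domino: "1 \<le> \<mu> (u, 2 * j) + \<mu> (u, 2 * j + 1)"
    if "(u, 2 * j) \<in> V" "(u, 2 * j + 1) \<in> V" for u j
  proof -
    have "{(u, 2 * j), (u, 2 * j + 1)} \<in> dominoes V" using that by (auto simp: dominoes_def)
    then show ?thesis using M by (fastforce simp: \<mu>_def)
  qed
  have inV: "(x, 6 * m + t) \<in> V" "(x + 1, 6 * m + t) \<in> V" if "t \<in> {0..5}" for t
    using sub[of "(x, 6 * m + t)"] that by (auto simp: k column_block_def)
  have strip: "2 \<le> \<mu> (x, 6 * m + t) + \<mu> (x + 1, 6 * m + t)
      + \<mu> (x, 6 * m + (t + 1)) + \<mu> (x + 1, 6 * m + (t + 1))" if "t \<in> {0, 2, 4}" for t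
  proof -
    have eq: "6 * m + t = 2 * (3 * m + t div 2)" using that by auto
    then have eq': "6 * m + (t + 1) = 2 * (3 * m + t div 2) + 1" by simp
    have "t \<in> {0..5}" "t + 1 \<in> {0..5}" using that by auto
    from this[THEN inV(1)] this[THEN inV(2)] show ?thesis
      using domino[of x "3 * m + t div 2"] domino[of "x + 1" "3 * m + t div 2"]
      unfolding eq eq' by linarith
  qed
  let ?good = "\<lambda>t. 2 \<le> card (unit_square (x, 6 * m + t) \<inter> M)"
  have even_good: "?good t" if "t \<in> {0, 2, 4}" for t
    using strip[OF that] by (simp add: card_sq add.assoc del: unit_square.simps)
  \<comment> \<open>The disjoint squares at offsets 1, 3, 5 cover the rows 2 to 5, where the strips
    at 2 and 4 give Maker at least four points; at most one point per square would give only
    three.\<close>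
  have "\<exists>t\<in>{1, 3, 5}. ?good t"
    using strip[of 2] strip[of 4] by (auto simp: card_sq add.assoc simp del: unit_square.simps)
  then obtain t where t: "t \<in> {1, 3, 5}" "?good t" by blast
  let ?T = "{0, 2, 4, t}"
  have "card ((\<lambda>t. (x, 6 * m + t)) ` ?T) = card ?T" by (intro card_image inj_onI) simp
  also have "card ?T = 4" using t(1) by auto
  finally have "4 = card ((\<lambda>t. (x, 6 * m + t)) ` ?T)" by simp
  also have "\<dots> \<le> card {p \<in> column_block k. 2 \<le> card (unit_square p \<inter> M)}"
  proof (rule card_mono)
    show "(\<lambda>t. (x, 6 * m + t)) ` ?T \<subseteq> {p \<in> column_block k. 2 \<le> card (unit_square p \<inter> M)}"
      using even_good[of 0] even_good[of 2] even_good[of 4] t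
      by (auto simp: k column_block_def simp del: unit_square.simps)
  qed (simp add: finite_column_block)
  finally show ?thesis .
qed

text \<open>Some corner \<open>w\<close> of the square at \<open>q\<close> is missing from
  \<open>V\<close>. Within a block, \<open>w\<close> differs from \<open>p\<close> by at most 1
  horizontally and 5 + 1 vertically, which gives the distance 7.\<close>

lemma near_boundary_if_block_incomplete:
  assumes p: "unit_square p \<subseteq> V" "p \<in> column_block k" and q: "q \<in> column_block k" "\<not> unit_square q \<subseteq> V"
  shows "unit_square p \<in> squares_near_boundary 7 V"
proof -
  obtain w where w: "w \<in> unit_square q" "w \<notin> V" using q by blast
  have pV: "p \<in> V" "p \<in> unit_square p" using p by (cases p; auto)+
  have "lattice_dist p w \<le> 7"
    using p(2) q(1) w(1) by (cases p; cases q) (auto simp: column_block_def split: prod.splits)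
  with boundary_within_dist[OF pV(1) w(2)] obtain b where "b \<in> boundary V" "lattice_dist p b \<le> 7"
    by (meson order.trans)
  then show ?thesis
    using p(1) pV unfolding squares_near_boundary_def square_grid_def snd_conv by blast
qed

text \<open>Let \<open>K\<close> be the set of complete blocks, \<open>S\<close> all squares and
  \<open>G\<close> the scoring ones. Then \<open>4 * card K \<le> card G\<close>, while
  \<open>S\<close> exceeds the \<open>6 * card K\<close> squares of complete blocks only by squares
  near the boundary; eliminating \<open>card K\<close> gives the bound.\<close>

lemma card_scored_squares:
  assumes fin: "finite V" and M: "\<And>a b. {a, b} \<in> dominoes V \<Longrightarrow> a \<in> M \<or> b \<in> M"
  shows "2 * num_squares V \<le> 3 * card {A \<in> winning_sets (square_grid V). 2 \<le> card (A \<inter> M)}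
      + 2 * card (squares_near_boundary 7 V)"
proof -
  define S where "S = {p. unit_square p \<subseteq> V}"
  define G where "G = {p \<in> S. 2 \<le> card (unit_square p \<inter> M)}"
  define K where "K = {k. column_block k \<subseteq> S}"
  have inj: "inj_on unit_square T" for T using inj_unit_square by (rule inj_on_subset) simp
  have ws: "winning_sets (square_grid V) = unit_square ` S" by (auto simp: square_grid_def S_def simp del: unit_square.simps)
  have "S \<subseteq> V" by (auto simp: S_def)
  then have finS: "finite S" using fin finite_subset by blast
  have nS: "num_squares V = card S" by (simp add: num_squares_def ws card_image[OF inj])
  have "{A \<in> winning_sets (square_grid V). 2 \<le> card (A \<inter> M)} = unit_square ` G"
    by (auto simp: ws G_def simp del: unit_square.simps)
  then have nG: "card {A \<in> winning_sets (square_grid V). 2 \<le> card (A \<inter> M)} = card G"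
    by (simp add: card_image[OF inj])
  have "(fst k, 6 * snd k) \<in> column_block k" for k
    by (cases k) (simp add: column_block_def)
  \<comment> \<open>The lowest square of each complete block embeds \<open>K\<close> into the finite
    set \<open>S\<close>.\<close>
  then have "(\<lambda>k. (fst k, 6 * snd k)) ` K \<subseteq> S" by (auto simp: K_def)
  then have finK: "finite K" by (rule inj_on_finite[rotated, OF _ finS]) (auto intro: inj_onI)
  have "4 * card K = (\<Sum>k\<in>K. 4)" by simp
  also have "\<dots> \<le> (\<Sum>k\<in>K. card {p \<in> column_block k. 2 \<le> card (unit_square p \<inter> M)})"
    by (intro sum_mono column_block_score[where V = V] M) (auto simp: K_def S_def simp del: unit_square.simps)
  also have "\<dots> = card (\<Union>k\<in>K. {p \<in> column_block k. 2 \<le> card (unit_square p \<inter> M)})"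
    using finK finite_column_block column_block_disjoint
    by (intro card_UN_disjoint[symmetric]) (simp, simp, blast)
  also have "\<dots> \<le> card G"
    using finS by (intro card_mono) (auto simp: G_def K_def simp del: unit_square.simps)
  finally have G4: "4 * card K \<le> card G" .
  have nU: "card (\<Union>k\<in>K. column_block k) = 6 * card K"
    using finK finite_column_block column_block_disjoint
    by (subst card_UN_disjoint) (auto simp: card_column_block)
  have "unit_square ` (S - (\<Union>k\<in>K. column_block k)) \<subseteq> squares_near_boundary 7 V"
  proof
    fix A assume "A \<in> unit_square ` (S - (\<Union>k\<in>K. column_block k))"
    then obtain p where p: "A = unit_square p" "p \<in> S" "p \<notin> (\<Union>k\<in>K. column_block k)" by blast
    have pk: "p \<in> column_block (fst p, snd p div 6)"
      by (simp add: mem_column_block_iff)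
    then have "(fst p, snd p div 6) \<notin> K" using p(3) by blast
    then obtain q where "q \<in> column_block (fst p, snd p div 6)" "\<not> unit_square q \<subseteq> V"
      by (auto simp: K_def S_def simp del: unit_square.simps)
    then show "A \<in> squares_near_boundary 7 V"
      using near_boundary_if_block_incomplete[OF _ pk] p by (auto simp: S_def simp del: unit_square.simps)
  qed
  moreover have "finite (squares_near_boundary 7 V)"
    by (rule finite_subset[of _ "unit_square ` S"]) (auto simp: squares_near_boundary_def ws finS simp del: unit_square.simps)
  ultimately have "card (S - (\<Union>k\<in>K. column_block k)) \<le> card (squares_near_boundary 7 V)"
    by (metis card_image card_mono inj)
  moreover have "card S - card (\<Union>k\<in>K. column_block k) \<le> card (S - (\<Union>k\<in>K. column_block k))"
    using finK finite_column_block by (intro diff_card_le_card_Diff) auto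
  ultimately have "card S \<le> 6 * card K + card (squares_near_boundary 7 V)" using nU by linarith
  then show ?thesis using G4 by (simp add: nS nG)
qed

lemma SC2_square_grid_ge:
  assumes fin: "finite V"
  shows "2 * num_squares V \<le> 3 * SC2 (square_grid V) 2 + 2 * card (squares_near_boundary 7 V)"
proof -
  let ?H = "square_grid V"
  \<comment> \<open>This is two thirds of the number of squares away from the boundary, rounded up.
    As the least solution it lies below the score of every play, so one number serves all
    strategies.\<close>
  define c where "c = (LEAST c. 2 * num_squares V \<le> 3 * c + 2 * card (squares_near_boundary 7 V))"
  have c: "2 * num_squares V \<le> 3 * c + 2 * card (squares_near_boundary 7 V)"
    unfolding c_def by (rule LeastI[of _ "num_squares V"]) simp
  have finH: "finite (verts ?H)" using fin by (simp add: square_grid_def)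
  have "winning_sets ?H \<subseteq> Pow V" by (auto simp: square_grid_def)
  then have "finite (winning_sets ?H)" using fin finite_subset by blast
  moreover have "pairing_guarantees ?H 2 (dominoes V) c"
    unfolding pairing_guarantees_def
  proof (intro allI impI)
    fix \<sigma> \<tau> assume "pairing_strategy ?H (dominoes V) \<sigma> \<and> breaker_strategy ?H \<tau>"
    then have "a \<in> maker_claims (play \<sigma> \<tau> (card (verts ?H))) \<or> b \<in> maker_claims (play \<sigma> \<tau> (card (verts ?H)))"
      if "{a, b} \<in> dominoes V" for a b
      using maker_claims_meets_pair[OF finH pairing_dominoes] that by blast
    from card_scored_squares[OF fin this]
    show "c \<le> score ?H 2 \<sigma> \<tau>" unfolding c_def score_def by (intro Least_le)
  qed
  ultimately have "c \<le> SC2 ?H 2" using SC2_ge pairing_dominoes by blast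
  then show ?thesis using c by linarith
qed

theorem theorem10:
  fixes V :: "nat \<Rightarrow> (int \<times> int) set"
  assumes "\<And>i. finite (V i)"
    and "filterlim (\<lambda>i. num_squares (V i)) at_top sequentially"
    and "two_dimensional V"
  shows "\<exists>e :: nat \<Rightarrow> real. e \<in> o(\<lambda>i. real (num_squares (V i))) \<and>
    (\<forall>i. real (SC2 (square_grid (V i)) 2) \<ge> 2 * real (num_squares (V i)) / 3 - e i)"
proof (intro exI conjI allI)
  \<comment> \<open>The error term is the number of squares within distance 7 of the boundary; the
    factor 2/3 that the finite bound gives it is rounded up to 1.\<close>
  show "(\<lambda>i. real (card (squares_near_boundary 7 (V i)))) \<in> o(\<lambda>i. real (num_squares (V i)))"
    using assms(3) by (simp add: two_dimensional_def)
  show "2 * real (num_squares (V i)) / 3 - real (card (squares_near_boundary 7 (V i)))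
      \<le> real (SC2 (square_grid (V i)) 2)" for i
    using SC2_square_grid_ge[OF assms(1)[of i]] by linarith
qed

end
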